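(* Suppose that the semicontinuous-model assumption (conditions (A1)–(A5) of the context) holds, and that the optimal value function $v_t^\star$ is convex on $\mathcal{Z}_t$ for all $t=0,\ldots,K$. Then $$0 \leq \hat{v}_t(x) - v_t^\star(x) \leq \sum_{k=t+1}^{K} L_k\,\delta \qquad \text{for all } x\in\mathcal{Z}_t \text{ and all } t=0,\ldots,K,$$ where $L_k := \sup_{j=1,\ldots,N_{\mathcal{C},k}}\ \sup_{x,x'\in\mathcal{C}_j,\ x\neq x'} \frac{|v_k^\star(x)-v_k^\star(x')|}{\|x-x'\|}$, and therefore $\hat{v}_t$ converges uniformly to $v_t^\star$ on $\mathcal{Z}_t$ as $\delta\to 0$.
   Context: Control problem. Let $K\ge 1$ be an integer, $\mathcal{X}\subseteq\mathbb{R}^n$, $\mathcal{U}\subseteq\mathbb{R}^m$, $\Xi\subseteq\mathbb{R}^l$ Borel sets, and for each $x\in\mathcal{X}$ let $\mathcal{U}(x)\subseteq\mathcal{U}$ be a nonempty Borel set of admissible actions; put $\mathcal{K}:=\{(x,u): x\in\mathcal{X},\,u\in\mathcal{U}(x)\}$. Let $f:\mathcal{X}\times\mathcal{U}\times\Xi\to\mathcal{X}$, $r:\mathcal{X}\times\mathcal{U}\to\mathbb{R}$ (stage cost) and $q:\mathcal{X}\to\mathbb{R}$ (terminal cost) be measurable. The system is $x_{t+1}=f(x_t,u_t,\xi_t)$ with i.i.d. disturbances $\xi_t$ distributed as $\xi$ with values in $\Xi$. Semicontinuous-model assumption: (A1) $\mathcal{U}(x)$ is compact for each $x\in\mathcal{X}$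 and the multifunction $x\mapsto\mathcal{U}(x)$ is upper semicontinuous. (A2) $r$ and $q$ are lower semicontinuous on $\mathcal{K}$ and $\mathcal{X}$, respectively. (A3) There exist nonnegative constants $\bar r,\bar q,\beta$ with $\beta\ge1$ and a continuous function $w:\mathcal{X}\to[1,\infty)$ such that $|r(x,u)|\le\bar r w(x)$, $|q(x)|\le\bar q w(x)$ and $\mathbb{E}[w(f(x,u,\xi))]\le\beta w(x)$ for all $(x,u)\in\mathcal{K}$. (A4) $(x,u)\mapsto f(x,u,\boldsymbol{\xi})$ is continuous on $\mathcal{K}$ for each $\boldsymbol{\xi}\in\Xi$. (A5) $\Xi=\{\hat\xi^{[1]},\ldots,\hat\xi^{[N]}\}$ is finite. Write $p_s:=\mathrm{Prob}(\xi=\hat\xi^{[s]})$, $\sum_{s=1}^N p_s=1$, and $\mathcal{S}:=\{1,\ldots,N\}$. Discretization. $\mathcal{Z}_0\subseteq\mathcal{Z}_1\subseteq\cdots\subseteq\mathcal{Z}_K\subseteq\mathcal{X}$ are convex compact sets with $\{f(x,u,\boldsymbol{\xi}):x\in\mathcal{Z}_t,u\in\mathcal{U}(x),\boldsymbol{\xi}\in\Xi\}\subseteq\mathcal{Z}_{t+1}$ for $t=0,\ldots,K-1$. $\mathcal{C}_1,\ldots,\mathcal{C}_{N_{\mathcal{C}}}$ are convex compact subsets (cells) of $\mathcal{Z}_K$ with pairwise disjoint interiors, and there are $N_{\mathcal{C},0}\le\cdots\le N_{\mathcal{C},K}=N_{\mathcal{C}}$ with $\bigcup_{i=1}^{N_{\mathcal{C},t}}\mathcal{C}_i=\mathcal{Z}_t$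 for every $t$. Nodes $x^{[1]},\ldots,x^{[M_K]}\in\mathcal{Z}_K$ are chosen so that each $\mathcal{C}_i$ is the convex hull of a subset of the nodes, and $M_0\le\cdots\le M_K$ are such that $x^{[1]},\ldots,x^{[M_t]}$ are exactly the nodes lying in $\mathcal{Z}_t$. Set $\delta:=\max_{k}\max_{x^{[i]},x^{[j]}\in\mathcal{C}_k}\|x^{[i]}-x^{[j]}\|$. "As $\delta\to0$" means that the sets $\mathcal{Z}_t$ are fixed while cells and nodes vary so that $\delta\to0$. Optimal value function. $v_K^{opt}:=q$ and $v_t^{opt}(x):=\inf_{u\in\mathcal{U}(x)}\{r(x,u)+\sum_{s=1}^N p_s v_{t+1}^{opt}(f(x,u,\hat\xi^{[s]}))\}$ for $x\in\mathcal{X}$, $t=K-1,\ldots,0$ (this is the minimal expected cost-to-go $\inf_\pi\mathbb{E}^\pi[\sum_{k=t}^{K-1}r(x_k,u_k)+q(x_K)\mid x_t=x]$); $v_t^\star$ is the restriction of $v_t^{opt}$ to $\mathcal{Z}_t$. Approximate operator. For bounded measurable $v:\mathcal{Z}_{t+1}\to\mathbb{R}$ and $x\in\mathcal{Z}_t$, $$(\hat T_t v)(x):=\inf_{u,\gamma}\Big\{r(x,u)+\sum_{s=1}^N\sum_{i=1}^{M_{t+1}}p_s\gamma_{s,i}v(x^{[i]})\ :\ f(x,u,\hat\xi^{[s]})=\sum_{i=1}^{M_{t+1}}\gamma_{s,i}x^{[i]},\ \gamma_s\in\Delta\ \forall s\in\mathcal{S},\ u\in\mathcal{U}(x)\Big\},$$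 where $\Delta:=\{\gamma\in\mathbb{R}^{M_{t+1}}:\sum_i\gamma_i=1,\ \gamma_i\ge0\}$. Define $\hat v_K:=q$ on $\mathcal{Z}_K$ and $\hat v_t:=\hat T_t\hat v_{t+1}$ on $\mathcal{Z}_t$ for $t=K-1,\ldots,0$. Conventions: a supremum over the empty set is $0$, an empty sum is $0$; an upper bound by $+\infty$ is vacuous. *)

theory Defs
  imports "HOL-Probability.Probability"
begin

definition lsc_on :: "'a::topological_space set \<Rightarrow> ('a \<Rightarrow> real) \<Rightarrow> bool" where
  "lsc_on S f \<longleftrightarrow> (\<forall>a. openin (top_of_set S) {x \<in> S. a < f x})"

(* Upper semicontinuity in the form in which HOL-Analysis states upper hemicontinuity. *)
definition usc_multifunction ::
    "'a::topological_space set \<Rightarrow> 'b::topological_space set \<Rightarrow> ('a \<Rightarrow> 'b set) \<Rightarrow> bool" where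
  "usc_multifunction S T F \<longleftrightarrow>
     (\<forall>V. openin (top_of_set T) V \<longrightarrow> openin (top_of_set S) {x \<in> S. F x \<subseteq> V})"

record ('x, 'u, 'd, 'o) control_problem =
  horizon :: nat
  states :: "'x set"
  actions :: "'u set"
  disturbances :: "'d set"
  admissible :: "'x \<Rightarrow> 'u set"
  dynamics :: "'x \<Rightarrow> 'u \<Rightarrow> 'd \<Rightarrow> 'x"
  stage_cost :: "'x \<Rightarrow> 'u \<Rightarrow> real"
  terminal_cost :: "'x \<Rightarrow> real"
  noise_space :: "'o measure"
  noise :: "'o \<Rightarrow> 'd"
  noise_process :: "nat \<Rightarrow> 'o \<Rightarrow> 'd"
  num_scenarios :: nat
  scenario :: "nat \<Rightarrow> 'd"

definition admissible_pairs :: "('x, 'u, 'd, 'o, 'z) control_problem_scheme \<Rightarrow> ('x \<times> 'u) set" where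
  "admissible_pairs P = (SIGMA x:states P. admissible P x)"

definition scenario_prob :: "('x, 'u, 'd, 'o, 'z) control_problem_scheme \<Rightarrow> nat \<Rightarrow> real" where
  "scenario_prob P s =
     measure (noise_space P) {\<omega> \<in> space (noise_space P). noise P \<omega> = scenario P s}"

locale control_model =
  fixes P :: "('x::euclidean_space, 'u::euclidean_space, 'd::euclidean_space, 'o) control_problem"
  assumes horizon: "horizon P \<ge> 1"
    and borel_sets: "states P \<in> sets borel" "actions P \<in> sets borel" "disturbances P \<in> sets borel"
    and admissible: "\<And>x. x \<in> states P \<Longrightarrow>
          admissible P x \<subseteq> actions P \<and> admissible P x \<noteq> {} \<and> admissible P x \<in> sets borel"
    and dynamics_into: "\<And>x u e. x \<in> states P \<Longrightarrow> u \<in> actions P \<Longrightarrow> e \<in> disturbances P \<Longrightarrow>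
          dynamics P x u e \<in> states P"
    and dynamics_measurable: "(\<lambda>(x, u, e). dynamics P x u e) \<in>
          borel_measurable (restrict_space borel (states P \<times> actions P \<times> disturbances P))"
    and stage_cost_measurable: "(\<lambda>(x, u). stage_cost P x u) \<in>
          borel_measurable (restrict_space borel (states P \<times> actions P))"
    and terminal_cost_measurable: "terminal_cost P \<in> borel_measurable (restrict_space borel (states P))"
    and noise_prob_space: "prob_space (noise_space P)"
    and noise_measurable: "noise P \<in> borel_measurable (noise_space P)"
    and noise_into: "\<And>\<omega>. \<omega> \<in> space (noise_space P) \<Longrightarrow> noise P \<omega> \<in> disturbances P"
    and noise_process_independent: "prob_space.indep_vars (noise_space P) (\<lambda>_. borel)
          (noise_process P) {..<horizon P}"
    and noise_process_distr: "\<And>t. t < horizon P \<Longrightarrow>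
          distr (noise_space P) borel (noise_process P t) = distr (noise_space P) borel (noise P)"

locale semicontinuous_model = control_model P
  for P :: "('x::euclidean_space, 'u::euclidean_space, 'd::euclidean_space, 'o) control_problem" +
  assumes admissible_compact: "\<And>x. x \<in> states P \<Longrightarrow> compact (admissible P x)"
    and admissible_usc: "usc_multifunction (states P) (actions P) (admissible P)"
    and stage_cost_lsc: "lsc_on (admissible_pairs P) (\<lambda>(x, u). stage_cost P x u)"
    and terminal_cost_lsc: "lsc_on (states P) (terminal_cost P)"
    and growth: "\<exists>rbar qbar \<beta> w. rbar \<ge> 0 \<and> qbar \<ge> 0 \<and> \<beta> \<ge> 1 \<and>
          continuous_on (states P) w \<and> (\<forall>x \<in> states P. (w x :: real) \<ge> 1) \<and>
          (\<forall>(x, u) \<in> admissible_pairs P.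
             \<bar>stage_cost P x u\<bar> \<le> rbar * w x \<and> \<bar>terminal_cost P x\<bar> \<le> qbar * w x \<and>
             prob_space.expectation (noise_space P) (\<lambda>\<omega>. w (dynamics P x u (noise P \<omega>))) \<le> \<beta> * w x)"
    and dynamics_continuous: "\<And>e. e \<in> disturbances P \<Longrightarrow>
          continuous_on (admissible_pairs P) (\<lambda>(x, u). dynamics P x u e)"
    and disturbances_finite: "disturbances P = scenario P ` {1..num_scenarios P}"
      \<comment> \<open>excludes repetitions in the enumeration of the scenarios that carry positive mass\<close>
    and scenario_prob_sum: "(\<Sum>s = 1..num_scenarios P. scenario_prob P s) = 1"

(* The real infima here and in approx_bellman range over nonempty sets that are bounded below,
   by the growth condition and, for the latter, because the cells cover the state regions. *)
definition bellman ::
    "('x, 'u, 'd, 'o, 'z) control_problem_scheme \<Rightarrow> ('x \<Rightarrow> real) \<Rightarrow> 'x \<Rightarrow> real" where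
  "bellman P v x = (INF u \<in> admissible P x.
     stage_cost P x u +
     (\<Sum>s = 1..num_scenarios P. scenario_prob P s * v (dynamics P x u (scenario P s))))"

function v_opt :: "('x, 'u, 'd, 'o, 'z) control_problem_scheme \<Rightarrow> nat \<Rightarrow> 'x \<Rightarrow> real" where
  "v_opt P t = (if t < horizon P then bellman P (v_opt P (Suc t)) else terminal_cost P)"
  by pat_completeness auto
termination by (relation "Wellfounded.measure (\<lambda>(P, t). horizon P - t)") auto

declare v_opt.simps [simp del]

record 'x discretization =
  cell :: "nat \<Rightarrow> 'x set"
  num_cells :: "nat \<Rightarrow> nat"
  node :: "nat \<Rightarrow> 'x"
  num_nodes :: "nat \<Rightarrow> nat"

definition state_regions ::
    "('x::euclidean_space, 'u, 'd, 'o, 'z) control_problem_scheme \<Rightarrow> (nat \<Rightarrow> 'x set) \<Rightarrow> bool" where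
  "state_regions P Z \<longleftrightarrow>
     (\<forall>t \<le> horizon P. convex (Z t) \<and> compact (Z t)) \<and>
     (\<forall>t < horizon P. Z t \<subseteq> Z (Suc t)) \<and>
     Z (horizon P) \<subseteq> states P \<and>
     (\<forall>t < horizon P. \<forall>x \<in> Z t. \<forall>u \<in> admissible P x. \<forall>e \<in> disturbances P.
        dynamics P x u e \<in> Z (Suc t))"

definition is_discretization ::
    "nat \<Rightarrow> (nat \<Rightarrow> 'x::euclidean_space set) \<Rightarrow> 'x discretization \<Rightarrow> bool" where
  "is_discretization K Z D \<longleftrightarrow>
     (\<forall>i \<in> {1..num_cells D K}. convex (cell D i) \<and> compact (cell D i) \<and> cell D i \<subseteq> Z K) \<and>
     disjoint_family_on (\<lambda>i. interior (cell D i)) {1..num_cells D K} \<and>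
     (\<forall>t < K. num_cells D t \<le> num_cells D (Suc t)) \<and>
     (\<forall>t \<le> K. (\<Union>i \<in> {1..num_cells D t}. cell D i) = Z t) \<and>
     (\<forall>i \<in> {1..num_nodes D K}. node D i \<in> Z K) \<and>
     (\<forall>i \<in> {1..num_cells D K}. \<exists>I \<subseteq> {1..num_nodes D K}. cell D i = convex hull (node D ` I)) \<and>
     (\<forall>t < K. num_nodes D t \<le> num_nodes D (Suc t)) \<and>
     (\<forall>t \<le> K. \<forall>i \<in> {1..num_nodes D K}. node D i \<in> Z t \<longleftrightarrow> i \<le> num_nodes D t)"

(* The inserted 0 only matters when no cell contains a node. *)
definition mesh :: "nat \<Rightarrow> 'x::euclidean_space discretization \<Rightarrow> real" where
  "mesh K D = Max (insert 0 {norm (node D i - node D j) | i j k.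
     k \<in> {1..num_cells D K} \<and> i \<in> {1..num_nodes D K} \<and> j \<in> {1..num_nodes D K} \<and>
     node D i \<in> cell D k \<and> node D j \<in> cell D k})"

definition unit_simplex :: "nat \<Rightarrow> (nat \<Rightarrow> real) set" where
  "unit_simplex m = {\<gamma>. (\<forall>i \<in> {1..m}. 0 \<le> \<gamma> i) \<and> (\<Sum>i = 1..m. \<gamma> i) = 1}"

definition approx_bellman ::
    "('x::euclidean_space, 'u, 'd, 'o, 'z) control_problem_scheme \<Rightarrow> 'x discretization \<Rightarrow> nat \<Rightarrow>
      ('x \<Rightarrow> real) \<Rightarrow> 'x \<Rightarrow> real" where
  "approx_bellman P D t v x = Inf
     {stage_cost P x u + (\<Sum>s = 1..num_scenarios P. \<Sum>i = 1..num_nodes D (Suc t).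
        scenario_prob P s * \<gamma> s i * v (node D i)) | u \<gamma>.
      (\<forall>s \<in> {1..num_scenarios P}.
         dynamics P x u (scenario P s) = (\<Sum>i = 1..num_nodes D (Suc t). \<gamma> s i *\<^sub>R node D i) \<and>
         \<gamma> s \<in> unit_simplex (num_nodes D (Suc t))) \<and>
      u \<in> admissible P x}"

function v_hat ::
    "('x::euclidean_space, 'u, 'd, 'o, 'z) control_problem_scheme \<Rightarrow> 'x discretization \<Rightarrow> nat \<Rightarrow>
      'x \<Rightarrow> real" where
  "v_hat P D t =
     (if t < horizon P then approx_bellman P D t (v_hat P D (Suc t)) else terminal_cost P)"
  by pat_completeness auto
termination by (relation "Wellfounded.measure (\<lambda>(P, D, t). horizon P - t)") auto

declare v_hat.simps [simp del]

(* In ennreal the supremum of the empty set is 0, and the value may be infinite. *)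
definition cell_lipschitz ::
    "('x::euclidean_space, 'u, 'd, 'o, 'z) control_problem_scheme \<Rightarrow> 'x discretization \<Rightarrow> nat \<Rightarrow>
      ennreal" where
  "cell_lipschitz P D k = (SUP j \<in> {1..num_cells D k}.
     SUP (x, x') \<in> {(x, x'). x \<in> cell D j \<and> x' \<in> cell D j \<and> x \<noteq> x'}.
       ennreal (\<bar>v_opt P k x - v_opt P k x'\<bar> / norm (x - x')))"

(* The limit in which the mesh of the discretizations of the fixed sets Z t tends to 0. *)
definition fine_discretizations ::
    "nat \<Rightarrow> (nat \<Rightarrow> 'x::euclidean_space set) \<Rightarrow> 'x discretization filter" where
  "fine_discretizations K Z =
     inf (filtercomap (mesh K) (nhds 0)) (principal {D. is_discretization K Z D})"

end

theory Submission
  imports Defs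
begin

text \<open>Jensen's inequality for the convex function \<open>v_opt P (t+1)\<close> shows that any convex combination
  of nodes overestimates the cost-to-go, hence \<open>v_opt \<le> v_hat\<close>. Conversely, the nodes of the cell
  containing the successor state give admissible weights whose excess is at most the oscillation
  of \<open>v_opt P (t+1)\<close> on that cell, and these excesses add up over time. Oscillations are at most
  Lipschitz constant times mesh. They also tend to 0 without any Lipschitz bound: the regions
  are polytopes as soon as a discretization exists, and a lower semicontinuous convex function
  on a polytope is continuous. Lower semicontinuity of \<open>v_opt\<close> (Berge's argument) also guarantees
  that the real infima are over sets bounded below.\<close>

section \<open>Lower semicontinuity\<close>

lemma lsc_on_compose:
  assumes g: "lsc_on T g" and f: "continuous_on S f" "f ` S \<subseteq> T"
  shows "lsc_on S (\<lambda>x. g (f x))"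
  unfolding lsc_on_def
proof
  fix a
  have "openin (top_of_set S) (S \<inter> f -` {y \<in> T. a < g y})"
    using g f by (intro continuous_openin_preimage[where T = T]) (auto simp: lsc_on_def)
  moreover have "S \<inter> f -` {y \<in> T. a < g y} = {x \<in> S. a < g (f x)}"
    using f(2) by auto
  ultimately show "openin (top_of_set S) {x \<in> S. a < g (f x)}" by simp
qed

lemma lsc_on_add:
  assumes f: "lsc_on S f" and g: "lsc_on S g"
  shows "lsc_on S (\<lambda>x. f x + g x)"
  unfolding lsc_on_def
proof
  fix a
  \<comment> \<open>The midpoint of \<open>a - g x\<close> and \<open>f x\<close> splits the level
    between the summands, so the superlevel set of the sum is a union of intersections of relatively
    open sets.\<close>
  have "\<exists>q. q < f x \<and> a - q < g x" if "a < f x + g x" for x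
    using that by (intro exI[of _ "(f x + a - g x) / 2"]) (auto simp: field_simps)
  then have "{x \<in> S. a < f x + g x} = (\<Union>q. {x \<in> S. q < f x} \<inter> {x \<in> S. a - q < g x})"
    by fastforce
  also have "openin (top_of_set S) \<dots>"
    using f g by (intro openin_Union openin_Int ballI) (auto simp: lsc_on_def intro!: openin_Int)
  finally show "openin (top_of_set S) {x \<in> S. a < f x + g x}" .
qed

lemma lsc_on_const: "lsc_on S (\<lambda>_. c)"
  unfolding lsc_on_def by (simp add: Collect_conj_eq)

lemma lsc_on_cmult:
  assumes f: "lsc_on S f" and c: "0 \<le> c"
  shows "lsc_on S (\<lambda>x. c * f x)"
proof (cases "c = 0")
  case True
  then show ?thesis by (simp add: lsc_on_const)
next
  case False
  then have "a < c * f x \<longleftrightarrow> a / c < f x" for a x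
    using c by (simp add: field_simps)
  then show ?thesis using f by (simp add: lsc_on_def)
qed

lemma lsc_on_sum:
  assumes "\<And>i. i \<in> I \<Longrightarrow> lsc_on S (f i)"
  shows "lsc_on S (\<lambda>x. \<Sum>i\<in>I. f i x)"
  using assms by (induction I rule: infinite_finite_induct) (auto intro: lsc_on_const lsc_on_add)

text \<open>The sets where \<open>f\<close> exceeds \<open>- real n\<close> are relatively open,
  grow with \<open>n\<close> and cover \<open>T\<close>; the largest index of a finite subcover
  gives the bound.\<close>

lemma lsc_on_compact_bounded_below:
  assumes T: "compact T" and f: "lsc_on T f"
  shows "\<exists>b. \<forall>x\<in>T. b \<le> f x"
proof -
  have "\<exists>U. open U \<and> {x \<in> T. - real n < f x} = T \<inter> U" for n :: nat
    using f by (simp add: lsc_on_def openin_open)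
  then obtain U where U: "\<And>n::nat. open (U n)" "\<And>n. {x \<in> T. - real n < f x} = T \<inter> U n"
    by metis
  have "T \<subseteq> (\<Union>n\<in>UNIV. U n)"
  proof
    fix x assume "x \<in> T"
    obtain n :: nat where "- f x < real n" using reals_Archimedean2 by blast
    with \<open>x \<in> T\<close> have "x \<in> {x \<in> T. - real n < f x}" by simp
    then show "x \<in> (\<Union>n\<in>UNIV. U n)" unfolding U(2) by blast
  qed
  then obtain I where I: "finite I" "T \<subseteq> (\<Union>n\<in>I. U n)"
    using compactE_image[OF T] U(1) by (metis (no_types, lifting) subset_UNIV)
  \<comment> \<open>An empty \<open>I\<close> leaves \<open>Max I\<close> unspecified, but then
    \<open>T\<close> is empty as well.\<close>
  have "- real (Max I) \<le> f x" if x: "x \<in> T" for x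
  proof -
    obtain n where n: "n \<in> I" "x \<in> U n" using I x by blast
    then have "- real n < f x" using U(2)[of n] x by blast
    moreover have "n \<le> Max I" using I n by simp
    ultimately show ?thesis by linarith
  qed
  then show ?thesis by blast
qed

text \<open>Tube-lemma form of Berge's argument: finitely many boxes inside the superlevel set cover
  the compact fibre over \<open>x0\<close>, and upper semicontinuity keeps the fibres over nearby
  points inside the union of their second factors.\<close>

lemma lsc_on_INF_usc_multifunction:
  assumes G: "lsc_on (SIGMA x:S. F x) (\<lambda>(x, u). G x u)"
    and F: "usc_multifunction S T F"
    and sub: "\<And>x. x \<in> S \<Longrightarrow> F x \<subseteq> T" "\<And>x. x \<in> S \<Longrightarrow> F x \<noteq> {}" "\<And>x. x \<in> S \<Longrightarrow> compact (F x)"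
    and bdd: "\<And>x. x \<in> S \<Longrightarrow> bdd_below (G x ` F x)"
  shows "lsc_on S (\<lambda>x. INF u\<in>F x. G x u)"
  unfolding lsc_on_def
proof
  fix a
  let ?m = "\<lambda>x. INF u\<in>F x. G x u"
  show "openin (top_of_set S) {x \<in> S. a < ?m x}"
  proof (subst openin_subopen, intro ballI)
    fix x0 assume "x0 \<in> {x \<in> S. a < ?m x}"
    then have x0: "x0 \<in> S" and "a < ?m x0" by auto
    \<comment> \<open>The intermediate level is there because a strict pointwise bound survives in
      the infimum only as a non-strict one.\<close>
    then obtain a' where a': "a < a'" "a' < ?m x0" using dense by blast
    obtain W where W: "open W"
      "{z \<in> (SIGMA x:S. F x). a' < (\<lambda>(x, u). G x u) z} = (SIGMA x:S. F x) \<inter> W"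
      using G unfolding lsc_on_def openin_open by blast
    have "\<exists>A B. open A \<and> open B \<and> x0 \<in> A \<and> u \<in> B \<and> A \<times> B \<subseteq> W" if u: "u \<in> F x0" for u
    proof -
      have "a' < G x0 u" using a'(2) cINF_lower[OF bdd[OF x0] u] by linarith
      with x0 u have "(x0, u) \<in> {z \<in> (SIGMA x:S. F x). a' < (\<lambda>(x, u). G x u) z}" by simp
      then have "(x0, u) \<in> W" unfolding W(2) by simp
      from open_prod_elim[OF W(1) this] show ?thesis by (metis mem_Sigma_iff)
    qed
    then obtain A B where AB: "\<And>u. u \<in> F x0 \<Longrightarrow> open (A u) \<and> open (B u) \<and> x0 \<in> A u \<and> u \<in> B u \<and> A u \<times> B u \<subseteq> W"
      by metis
    obtain C where C: "C \<subseteq> F x0" "finite C" "F x0 \<subseteq> (\<Union>u\<in>C. B u)"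
    proof (rule compactE_image[OF sub(3)[OF x0], of "F x0" B])
      show "open (B u)" if "u \<in> F x0" for u using AB[OF that] by blast
      show "F x0 \<subseteq> (\<Union>u\<in>F x0. B u)" using AB by blast
    qed
    define V where "V = T \<inter> (\<Union>u\<in>C. B u)"
    have V: "openin (top_of_set T) V"
      unfolding V_def using AB C by (intro openin_open_Int open_UN) auto
    let ?N = "{x \<in> S. F x \<subseteq> V} \<inter> (S \<inter> (\<Inter>u\<in>C. A u))"
    have "openin (top_of_set S) ?N"
      using F V AB C unfolding usc_multifunction_def
      by (intro openin_Int openin_open_Int open_INT) auto
    moreover have "x0 \<in> ?N"
      using x0 C AB sub(1)[OF x0] by (auto simp: V_def)
    moreover have "a < ?m x" if x: "x \<in> ?N" for x
    proof -
      have "a' \<le> ?m x"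
      proof (rule cINF_greatest)
        show "F x \<noteq> {}" using x sub by auto
        fix u assume u: "u \<in> F x"
        then obtain c where c: "c \<in> C" "u \<in> B c" using x by (auto simp: V_def)
        then have "(x, u) \<in> A c \<times> B c" using x by auto
        then have "(x, u) \<in> W" using AB C(1) c(1) by blast
        then have "(x, u) \<in> {z \<in> (SIGMA x:S. F x). a' < (\<lambda>(x, u). G x u) z}"
          unfolding W(2) using x u by simp
        then show "a' \<le> G x u" by simp
      qed
      with a' show ?thesis by linarith
    qed
    ultimately show "\<exists>N. openin (top_of_set S) N \<and> x0 \<in> N \<and> N \<subseteq> {x \<in> S. a < ?m x}"
      by (intro exI[of _ ?N]) auto
  qed
qed

section \<open>Convex functions on polytopes\<close>

text \<open>Near \<open>x\<close> a polyhedron is a cone. The finitely many half-spaces with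
  \<open>x\<close> in the interior share a ball around \<open>x\<close>; those with \<open>x\<close>
  on the boundary contain every ray from \<open>x\<close> through a point of \<open>S\<close>. Hence
  \<rho> does not depend on the direction.\<close>

lemma polyhedron_locally_conic:
  assumes S: "polyhedron S" and x: "x \<in> S"
  obtains \<rho> where "0 < \<rho>"
    "\<And>y. y \<in> S \<Longrightarrow> y \<noteq> x \<Longrightarrow> x + (\<rho> / norm (y - x)) *\<^sub>R (y - x) \<in> S"
proof -
  obtain F where F: "finite F" "S = \<Inter>F" "\<And>h. h \<in> F \<Longrightarrow> \<exists>a b. a \<noteq> 0 \<and> h = {x. a \<bullet> x \<le> b}"
    using S unfolding polyhedron_def by metis
  let ?O = "\<Inter>h\<in>{h \<in> F. x \<in> interior h}. interior h"
  have "open ?O" "x \<in> ?O" using F(1) by (auto intro!: open_INT)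
  then obtain e where e: "0 < e" "ball x e \<subseteq> ?O" using open_contains_ball by metis
  define \<rho> where "\<rho> = e / 2"
  have "x + (\<rho> / norm (y - x)) *\<^sub>R (y - x) \<in> h" if y: "y \<in> S" "y \<noteq> x" and h: "h \<in> F" for y h
  proof (cases "x \<in> interior h")
    case True
    have "dist x (x + (\<rho> / norm (y - x)) *\<^sub>R (y - x)) < e"
      using e(1) y by (simp add: \<rho>_def dist_norm)
    then have "x + (\<rho> / norm (y - x)) *\<^sub>R (y - x) \<in> ?O" using e(2) by (simp add: subset_iff)
    then have "x + (\<rho> / norm (y - x)) *\<^sub>R (y - x) \<in> interior h" using True h by blast
    then show ?thesis using interior_subset by blast
  next
    case False
    obtain a b where ab: "a \<noteq> 0" "h = {x. a \<bullet> x \<le> b}" using F(3)[OF h] by blast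
    \<comment> \<open>A point of a half-space outside its interior lies on the bounding hyperplane,
      so \<open>y - x\<close> does not point outwards, nor does any nonnegative multiple.\<close>
    have "a \<bullet> x = b" using False x h F(2) ab by (force simp: interior_halfspace_le)
    moreover have "a \<bullet> y \<le> b" using y h F(2) ab by auto
    ultimately have "a \<bullet> (y - x) \<le> 0" by (simp add: inner_diff_right)
    then have "(\<rho> / norm (y - x)) * (a \<bullet> (y - x)) \<le> 0"
      using e(1) by (intro mult_nonneg_nonpos) (auto simp: \<rho>_def)
    then show ?thesis using ab \<open>a \<bullet> x = b\<close> by (simp add: inner_add_right)
  qed
  then show thesis using e(1) F(2) by (intro that[of \<rho>]) (auto simp: \<rho>_def)
qed

text \<open>A convex function on a polytope is upper semicontinuous (Gale, Klee and Rockafellar):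
  it lies below the chord from \<open>x\<close> to a point of the polytope at fixed distance from \<open>x\<close>.\<close>

lemma convex_on_polytope_lsc_imp_continuous:
  fixes v :: "'a::euclidean_space \<Rightarrow> real"
  assumes S: "polytope S" and v: "convex_on S v" and lsc: "lsc_on S v"
  shows "continuous_on S v"
  unfolding continuous_on_iff
proof (intro ballI allI impI)
  fix x and e :: real assume x: "x \<in> S" and e: "0 < e"
  obtain V where V: "finite V" "S = convex hull V" using S unfolding polytope_def by metis
  obtain M0 where "\<forall>y\<in>V. v y \<le> M0"
    using V(1) by (metis Max_ge finite_imageI imageI)
  then have "\<forall>y\<in>S. v y \<le> M0" using convex_on_convex_hull_bound v V(2) by blast
  then obtain M where M: "\<And>y. y \<in> S \<Longrightarrow> v y \<le> M" "v x < M"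
    by (metis dual_order.strict_trans2 gt_ex linorder_not_less order.trans order_le_less)
  obtain \<rho> where \<rho>: "0 < \<rho>"
    "\<And>y. y \<in> S \<Longrightarrow> y \<noteq> x \<Longrightarrow> x + (\<rho> / norm (y - x)) *\<^sub>R (y - x) \<in> S"
    using polyhedron_locally_conic[OF polytope_imp_polyhedron[OF S] x] by metis
  have "openin (top_of_set S) {y \<in> S. v x - e < v y}" using lsc by (simp add: lsc_on_def)
  then obtain d where d: "0 < d" "\<And>y. y \<in> S \<Longrightarrow> dist y x < d \<Longrightarrow> v x - e < v y"
    using x e unfolding openin_euclidean_subtopology_iff
    by (metis (mono_tags, lifting) diff_less_eq less_add_same_cancel1 mem_Collect_eq)
  \<comment> \<open>Here \<open>d\<close> limits the drop of \<open>v\<close> below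
    \<open>v x\<close>, \<rho> keeps the chord parameter \<open>l\<close> at most 1, and the third
    term keeps the rise \<open>l * (M - v x)\<close> of the chord below \<open>e\<close>; it is
    positive because \<open>M\<close> was chosen strictly above \<open>v x\<close>.\<close>
  define d' where "d' = min d (min \<rho> (\<rho> * e / (M - v x)))"
  have "0 < d'" using d \<rho> e M by (simp add: d'_def)
  moreover have "dist (v y) (v x) < e" if y: "y \<in> S" "dist y x < d'" for y
  proof (cases "y = x")
    case False
    define l where "l = norm (y - x) / \<rho>"
    define z where "z = x + (\<rho> / norm (y - x)) *\<^sub>R (y - x)"
    have "z \<in> S" using \<rho>(2) y(1) False by (simp add: z_def)
    have l: "0 \<le> l" "l \<le> 1" using y(2) \<rho>(1) by (auto simp: l_def d'_def dist_norm)
    have "(1 - l) *\<^sub>R x + l *\<^sub>R z = y"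
      using False \<rho>(1) by (simp add: l_def z_def algebra_simps)
    then have "v y \<le> (1 - l) * v x + l * v z"
      using convex_onD[OF v l x \<open>z \<in> S\<close>] by simp
    also have "\<dots> \<le> (1 - l) * v x + l * M"
      using l M(1)[OF \<open>z \<in> S\<close>] by (intro add_left_mono mult_left_mono)
    also have "\<dots> = v x + l * (M - v x)" by (simp add: algebra_simps)
    also have "l * (M - v x) < e"
      using y(2) \<rho>(1) M(2) by (simp add: l_def d'_def dist_norm field_simps)
    finally have "v y < v x + e" by simp
    moreover have "v x - e < v y" using d(2) y by (simp add: d'_def)
    ultimately show ?thesis by (simp add: dist_real_def)
  qed (use e in simp)
  ultimately show "\<exists>d>0. \<forall>y\<in>S. dist y x < d \<longrightarrow> dist (v y) (v x) < e" by blast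
qed

section \<open>Discretizations\<close>

lemma discretization_num_cells_mono:
  assumes "is_discretization K Z D" "t \<le> K"
  shows "num_cells D t \<le> num_cells D K"
  using assms(2,1)
  by (induction rule: inc_induct) (auto simp: is_discretization_def intro: order_trans)

lemma discretization_num_nodes_mono:
  assumes "is_discretization K Z D" "t \<le> K"
  shows "num_nodes D t \<le> num_nodes D K"
  using assms(2,1)
  by (induction rule: inc_induct) (auto simp: is_discretization_def intro: order_trans)

lemma discretization_region_eq:
  assumes "is_discretization K Z D" "t \<le> K"
  shows "Z t = (\<Union>j\<in>{1..num_cells D t}. cell D j)"
  using assms by (simp add: is_discretization_def)

lemma discretization_node_iff:
  assumes "is_discretization K Z D" "t \<le> K" "i \<in> {1..num_nodes D K}"
  shows "node D i \<in> Z t \<longleftrightarrow> i \<le> num_nodes D t"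
  using assms by (simp add: is_discretization_def)

lemma discretization_cell_hull_final:
  assumes "is_discretization K Z D" "j \<in> {1..num_cells D K}"
  shows "\<exists>I \<subseteq> {1..num_nodes D K}. cell D j = convex hull (node D ` I)"
  using assms by (simp add: is_discretization_def)

lemma discretization_node_in_region:
  assumes D: "is_discretization K Z D" and t: "t \<le> K" and i: "i \<in> {1..num_nodes D t}"
  shows "node D i \<in> Z t"
  using discretization_node_iff[OF D t, of i] discretization_num_nodes_mono[OF D t] i by auto

text \<open>The operator at a given stage may only use the first nodes of the enumeration. Those
  spanning a cell of \<open>Z t\<close> lie in \<open>Z t\<close>, so they are among the first
  \<open>num_nodes D t\<close>.\<close>

lemma discretization_cell_hull:
  assumes D: "is_discretization K Z D" and t: "t \<le> K" and j: "j \<in> {1..num_cells D t}"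
  obtains I where "I \<subseteq> {1..num_nodes D t}" "cell D j = convex hull (node D ` I)"
proof -
  have jK: "j \<in> {1..num_cells D K}" using j discretization_num_cells_mono[OF D t] by auto
  then obtain I where I: "I \<subseteq> {1..num_nodes D K}" "cell D j = convex hull (node D ` I)"
    using discretization_cell_hull_final[OF D] by blast
  have "cell D j \<subseteq> Z t" using discretization_region_eq[OF D t] j by blast
  then have "node D i \<in> Z t" if "i \<in> I" for i using I(2) that hull_subset[of "node D ` I" convex] by blast
  then have "I \<subseteq> {1..num_nodes D t}" using I(1) discretization_node_iff[OF D t] by fastforce
  with I(2) show thesis by (intro that)
qed

text \<open>The cells cover the region and are spanned by its nodes; convexity gives the converse
  inclusion, so the region is the hull of its finitely many nodes.\<close>

lemma discretization_region_polytope: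
  assumes D: "is_discretization K Z D" and t: "t \<le> K" and Z: "convex (Z t)"
  shows "polytope (Z t)"
proof -
  let ?N = "node D ` {1..num_nodes D t}"
  have "Z t \<subseteq> convex hull ?N"
  proof
    fix x assume "x \<in> Z t"
    then obtain j where j: "j \<in> {1..num_cells D t}" "x \<in> cell D j"
      using discretization_region_eq[OF D t] by blast
    obtain I where "I \<subseteq> {1..num_nodes D t}" "cell D j = convex hull (node D ` I)"
      using discretization_cell_hull[OF D t j(1)] .
    then show "x \<in> convex hull ?N" using j(2) hull_mono[of "node D ` I" ?N convex] by blast
  qed
  moreover have "convex hull ?N \<subseteq> Z t"
    using discretization_node_in_region[OF D t] Z by (intro hull_minimal) auto
  ultimately have "Z t = convex hull ?N" by auto
  then show ?thesis unfolding polytope_def by blast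
qed

section \<open>Mesh size and cell diameters\<close>

lemma finite_mesh_set:
  "finite {norm (node D i - node D j) | i j k.
     k \<in> {1..num_cells D K} \<and> i \<in> {1..num_nodes D K} \<and> j \<in> {1..num_nodes D K} \<and>
     node D i \<in> cell D k \<and> node D j \<in> cell D k}"
  by (rule finite_subset[of _ "(\<lambda>(i, j). norm (node D i - node D j)) `
        ({1..num_nodes D K} \<times> {1..num_nodes D K})"]) auto

lemma mesh_nonneg: "0 \<le> mesh K D"
  unfolding mesh_def using finite_mesh_set by (intro Max_ge) auto

lemma mesh_ge_node_dist:
  assumes "k \<in> {1..num_cells D K}" "i \<in> {1..num_nodes D K}" "j \<in> {1..num_nodes D K}"
    "node D i \<in> cell D k" "node D j \<in> cell D k"
  shows "norm (node D i - node D j) \<le> mesh K D"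
  unfolding mesh_def using finite_mesh_set assms by (intro Max_ge) auto

text \<open>Balls are convex, so minimality of the hull extends the bound first in one argument and
  then in the other.\<close>

lemma convex_hull_dist_le:
  fixes S :: "'a::real_normed_vector set"
  assumes "\<And>x y. x \<in> S \<Longrightarrow> y \<in> S \<Longrightarrow> dist x y \<le> d"
    and x: "x \<in> convex hull S" and y: "y \<in> convex hull S"
  shows "dist x y \<le> d"
proof -
  have "convex hull S \<subseteq> cball x d" if "x \<in> S" for x
    using assms(1) that by (intro hull_minimal convex_cball) auto
  then have "convex hull S \<subseteq> cball y d"
    using y by (intro hull_minimal convex_cball) (fastforce simp: dist_commute)
  then show ?thesis using x by (auto simp: dist_commute)
qed

lemma cell_dist_le_mesh:
  assumes D: "is_discretization K Z D" and t: "t \<le> K" and j: "j \<in> {1..num_cells D t}"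
    and x: "x \<in> cell D j" "y \<in> cell D j"
  shows "dist x y \<le> mesh K D"
proof -
  have jK: "j \<in> {1..num_cells D K}" using j discretization_num_cells_mono[OF D t] by auto
  obtain I where I: "I \<subseteq> {1..num_nodes D K}" "cell D j = convex hull (node D ` I)"
    using discretization_cell_hull[OF D order_refl jK] .
  have "node D i \<in> cell D j" if "i \<in> I" for i
    using I(2) that hull_subset[of "node D ` I" convex] by blast
  then have "dist a b \<le> mesh K D" if "a \<in> node D ` I" "b \<in> node D ` I" for a b
    using that I(1) by (auto simp: dist_norm intro!: mesh_ge_node_dist[OF jK])
  then show ?thesis using convex_hull_dist_le x I(2) by metis
qed

section \<open>Interpolation by nodes\<close>

text \<open>Several indices may name the same point. The weights of the points are therefore placed
  on one index per point, collected in \<open>g\<close>, and all other indices get 0.\<close>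

lemma convex_hull_image_weights:
  fixes p :: "'i \<Rightarrow> 'a::real_vector"
  assumes J: "finite J" "I \<subseteq> J" and y: "y \<in> convex hull (p ` I)"
  obtains \<gamma> where "\<And>i. 0 \<le> \<gamma> i" "\<And>i. i \<notin> I \<Longrightarrow> \<gamma> i = (0::real)" "sum \<gamma> J = 1"
    "(\<Sum>i\<in>J. \<gamma> i *\<^sub>R p i) = y"
proof -
  have I: "finite I" using J finite_subset by blast
  obtain g where g: "inj_on p g" "g \<subseteq> I" "p ` g = p ` I"
    by (metis subset_image_inj order_refl)
  then have fg: "finite g" using I finite_subset by blast
  obtain u where u: "\<forall>x\<in>p ` I. 0 \<le> u x" "sum u (p ` I) = 1" "(\<Sum>x\<in>p ` I. u x *\<^sub>R x) = y"
    using y I by (auto simp: convex_hull_finite)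
  define \<gamma> where "\<gamma> i = (if i \<in> g then u (p i) else 0)" for i
  have gJ: "g \<subseteq> J" using g(2) J(2) by blast
  have "sum \<gamma> J = sum \<gamma> g" using J(1) gJ by (intro sum.mono_neutral_right) (auto simp: \<gamma>_def)
  also have "\<dots> = sum u (p ` g)" using g(1) by (simp add: sum.reindex \<gamma>_def)
  finally have 1: "sum \<gamma> J = 1" using u(2) g(3) by simp
  have "(\<Sum>i\<in>J. \<gamma> i *\<^sub>R p i) = (\<Sum>i\<in>g. \<gamma> i *\<^sub>R p i)"
    using J(1) gJ by (intro sum.mono_neutral_right) (auto simp: \<gamma>_def)
  also have "\<dots> = (\<Sum>x\<in>p ` g. u x *\<^sub>R x)" using g(1) by (simp add: sum.reindex \<gamma>_def)
  finally have 2: "(\<Sum>i\<in>J. \<gamma> i *\<^sub>R p i) = y" using u(3) g(3) by simp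
  have "0 \<le> \<gamma> i" "i \<notin> I \<Longrightarrow> \<gamma> i = 0" for i using u(1) g(2) by (auto simp: \<gamma>_def)
  then show thesis using that 1 2 by blast
qed

text \<open>Common interface of both error estimates: \<omega> is Lipschitz constant times mesh in
  one and a bound from uniform continuity in the other. Asking for a bound avoids a real supremum
  over a possibly unbounded set.\<close>

definition cell_oscillation_le ::
    "'x::euclidean_space discretization \<Rightarrow> nat \<Rightarrow> ('x \<Rightarrow> real) \<Rightarrow> real \<Rightarrow> bool" where
  "cell_oscillation_le D t v \<omega> \<longleftrightarrow>
     (\<forall>j\<in>{1..num_cells D t}. \<forall>x\<in>cell D j. \<forall>x'\<in>cell D j. \<bar>v x - v x'\<bar> \<le> \<omega>)"

text \<open>Evaluating \<open>v\<close> at the nodes of the cell around \<open>y\<close> only costs the oscillation of \<open>v\<close> on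
  that cell.\<close>

lemma discretization_interpolation:
  assumes D: "is_discretization K Z D" and t: "t \<le> K" and y: "y \<in> Z t"
    and osc: "cell_oscillation_le D t v \<omega>"
  obtains \<gamma> where "\<gamma> \<in> unit_simplex (num_nodes D t)"
    "y = (\<Sum>i = 1..num_nodes D t. \<gamma> i *\<^sub>R node D i)"
    "(\<Sum>i = 1..num_nodes D t. \<gamma> i * v (node D i)) \<le> v y + \<omega>"
proof -
  obtain j where j: "j \<in> {1..num_cells D t}" "y \<in> cell D j"
    using discretization_region_eq[OF D t] y by blast
  obtain I where I: "I \<subseteq> {1..num_nodes D t}" "cell D j = convex hull (node D ` I)"
    using discretization_cell_hull[OF D t j(1)] .
  have y': "y \<in> convex hull (node D ` I)" using I j by simp
  obtain \<gamma> where \<gamma>: "\<And>i. 0 \<le> \<gamma> i" "\<And>i. i \<notin> I \<Longrightarrow> \<gamma> i = 0" "sum \<gamma> {1..num_nodes D t} = 1"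
    "(\<Sum>i = 1..num_nodes D t. \<gamma> i *\<^sub>R node D i) = y"
    using convex_hull_image_weights[OF finite_atLeastAtMost I(1) y'] by metis
  \<comment> \<open>Nodes outside the chosen spanning set carry weight 0, so the value of
    \<open>v\<close> there is irrelevant.\<close>
  have "\<gamma> i * v (node D i) \<le> \<gamma> i * (v y + \<omega>)" for i
  proof (cases "i \<in> I")
    case True
    then have "node D i \<in> cell D j" using I(2) hull_subset[of "node D ` I" convex] by blast
    then have "\<bar>v (node D i) - v y\<bar> \<le> \<omega>"
      using osc j unfolding cell_oscillation_le_def by blast
    then have "v (node D i) \<le> v y + \<omega>" by linarith
    then show ?thesis using \<gamma>(1) by (intro mult_left_mono)
  qed (use \<gamma>(2) in simp)
  then have "(\<Sum>i = 1..num_nodes D t. \<gamma> i * v (node D i)) \<le>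
      (\<Sum>i = 1..num_nodes D t. \<gamma> i * (v y + \<omega>))" by (intro sum_mono)
  also have "\<dots> = v y + \<omega>" using \<gamma>(3) by (simp flip: sum_distrib_right)
  finally show thesis using that[of \<gamma>] \<gamma> by (auto simp: unit_simplex_def)
qed

lemma state_regions_subset_states:
  assumes Z: "state_regions P Z" and t: "t \<le> horizon P"
  shows "Z t \<subseteq> states P"
  using t
proof (induction rule: inc_induct)
  case base
  then show ?case using Z by (simp add: state_regions_def)
next
  case (step n)
  then show ?case using Z by (auto simp: state_regions_def)
qed

section \<open>Error bounds\<close>

lemma v_hat_Suc: "t < horizon P \<Longrightarrow> v_hat P D t = approx_bellman P D t (v_hat P D (Suc t))"
  by (subst v_hat.simps) simp

lemma v_opt_Suc: "t < horizon P \<Longrightarrow> v_opt P t = bellman P (v_opt P (Suc t))"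
  by (subst v_opt.simps) simp

lemma v_opt_horizon: "v_opt P (horizon P) = terminal_cost P"
  by (subst v_opt.simps) simp

lemma v_hat_horizon: "v_hat P D (horizon P) = terminal_cost P"
  by (subst v_hat.simps) simp

lemma scenario_prob_nonneg: "0 \<le> scenario_prob P s"
  by (simp add: scenario_prob_def)

section \<open>Lower semicontinuity of the optimal value functions\<close>

lemma (in semicontinuous_model) scenario_in_disturbances:
  "s \<in> {1..num_scenarios P} \<Longrightarrow> scenario P s \<in> disturbances P"
  by (simp add: disturbances_finite)

lemma (in semicontinuous_model) bellman_objective_lsc:
  assumes v: "lsc_on (states P) v"
  shows "lsc_on (admissible_pairs P) (\<lambda>(x, u). stage_cost P x u +
     (\<Sum>s = 1..num_scenarios P. scenario_prob P s * v (dynamics P x u (scenario P s))))"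
proof -
  have "lsc_on (admissible_pairs P) (\<lambda>k. v ((\<lambda>(x, u). dynamics P x u (scenario P s)) k))"
    if s: "s \<in> {1..num_scenarios P}" for s
    using scenario_in_disturbances[OF s]
    by (intro lsc_on_compose[OF v dynamics_continuous])
      (use admissible dynamics_into in \<open>auto simp: admissible_pairs_def, blast\<close>)
  then have "lsc_on (admissible_pairs P) (\<lambda>k. (\<lambda>(x, u). stage_cost P x u) k +
     (\<Sum>s = 1..num_scenarios P. scenario_prob P s *
        v ((\<lambda>(x, u). dynamics P x u (scenario P s)) k)))"
    by (intro lsc_on_add lsc_on_sum lsc_on_cmult stage_cost_lsc scenario_prob_nonneg) auto
  then show ?thesis by (simp add: case_prod_unfold)
qed

text \<open>For fixed \<open>x\<close> the objective is lower semicontinuous on a compact action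
  set. This makes the real infimum in \<open>bellman\<close> a genuine lower bound.\<close>

lemma (in semicontinuous_model) bellman_objective_bdd_below:
  assumes v: "lsc_on (states P) v" and x: "x \<in> states P"
  shows "bdd_below ((\<lambda>u. stage_cost P x u +
     (\<Sum>s = 1..num_scenarios P. scenario_prob P s * v (dynamics P x u (scenario P s)))) `
     admissible P x)"
proof -
  have "lsc_on (admissible P x) (\<lambda>u. (\<lambda>(x, u). stage_cost P x u +
     (\<Sum>s = 1..num_scenarios P. scenario_prob P s * v (dynamics P x u (scenario P s)))) (x, u))"
    using x by (intro lsc_on_compose[OF bellman_objective_lsc[OF v]] continuous_intros)
      (auto simp: admissible_pairs_def)
  from lsc_on_compact_bounded_below[OF admissible_compact[OF x] this]
  show ?thesis by (auto simp: bdd_below_def)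
qed

lemma (in semicontinuous_model) bellman_lsc:
  assumes v: "lsc_on (states P) v"
  shows "lsc_on (states P) (bellman P v)"
  unfolding bellman_def
proof (rule lsc_on_INF_usc_multifunction[OF _ admissible_usc])
  show "lsc_on (Sigma (states P) (admissible P)) (\<lambda>(x, u). stage_cost P x u +
     (\<Sum>s = 1..num_scenarios P. scenario_prob P s * v (dynamics P x u (scenario P s))))"
    using bellman_objective_lsc[OF v] unfolding admissible_pairs_def .
next
  fix x assume x: "x \<in> states P"
  show "admissible P x \<subseteq> actions P" "admissible P x \<noteq> {}" "compact (admissible P x)"
    using admissible[OF x] admissible_compact[OF x] by simp_all
  show "bdd_below ((\<lambda>u. stage_cost P x u +
     (\<Sum>s = 1..num_scenarios P. scenario_prob P s * v (dynamics P x u (scenario P s)))) `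
     admissible P x)" by (rule bellman_objective_bdd_below[OF v x])
qed

lemma (in semicontinuous_model) v_opt_lsc:
  assumes "t \<le> horizon P"
  shows "lsc_on (states P) (v_opt P t)"
  using assms
proof (induction rule: inc_induct)
  case base
  show ?case using terminal_cost_lsc by (simp add: v_opt_horizon)
next
  case (step n)
  then show ?case by (simp add: v_opt_Suc bellman_lsc)
qed

section \<open>One-step error of the approximate operator\<close>

text \<open>Jensen's inequality at each successor state bounds \<open>v\<close> by the weighted node
  values of \<open>v\<close>, and these by the ones of \<open>h\<close>.\<close>

lemma (in semicontinuous_model) approx_bellman_objective_ge:
  assumes Z: "state_regions P Z" and D: "is_discretization (horizon P) Z D"
    and t: "t < horizon P" and x: "x \<in> Z t" and u: "u \<in> admissible P x"
    and v: "convex_on (Z (Suc t)) v" "lsc_on (states P) v"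
    and h: "\<And>y. y \<in> Z (Suc t) \<Longrightarrow> v y \<le> h y"
    and \<gamma>: "\<And>s. s \<in> {1..num_scenarios P} \<Longrightarrow>
         dynamics P x u (scenario P s) = (\<Sum>i = 1..num_nodes D (Suc t). \<gamma> s i *\<^sub>R node D i) \<and>
         \<gamma> s \<in> unit_simplex (num_nodes D (Suc t))"
  shows "bellman P v x \<le> stage_cost P x u + (\<Sum>s = 1..num_scenarios P.
     \<Sum>i = 1..num_nodes D (Suc t). scenario_prob P s * \<gamma> s i * h (node D i))"
proof -
  have node: "node D i \<in> Z (Suc t)" if "i \<in> {1..num_nodes D (Suc t)}" for i
    using discretization_node_in_region[OF D] t that by simp
  have "bellman P v x \<le> stage_cost P x u +
     (\<Sum>s = 1..num_scenarios P. scenario_prob P s * v (dynamics P x u (scenario P s)))"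
    unfolding bellman_def
    using bellman_objective_bdd_below[OF v(2)] state_regions_subset_states[OF Z, of t] t x u
    by (intro cINF_lower) auto
  also have "\<dots> \<le> stage_cost P x u + (\<Sum>s = 1..num_scenarios P.
     scenario_prob P s * (\<Sum>i = 1..num_nodes D (Suc t). \<gamma> s i * h (node D i)))"
  proof (intro add_left_mono sum_mono mult_left_mono scenario_prob_nonneg)
    fix s assume s: "s \<in> {1..num_scenarios P}"
    have g: "\<And>i. i \<in> {1..num_nodes D (Suc t)} \<Longrightarrow> 0 \<le> \<gamma> s i" "sum (\<gamma> s) {1..num_nodes D (Suc t)} = 1"
      using \<gamma>[OF s] by (auto simp: unit_simplex_def)
    have "v (dynamics P x u (scenario P s)) = v (\<Sum>i = 1..num_nodes D (Suc t). \<gamma> s i *\<^sub>R node D i)"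
      using \<gamma>[OF s] by simp
    also have "\<dots> \<le> (\<Sum>i = 1..num_nodes D (Suc t). \<gamma> s i * v (node D i))"
    proof (rule convex_on_sum[OF _ _ v(1)])
      \<comment> \<open>Weights over an empty index set would sum to 0 instead of 1.\<close>
      show "{1..num_nodes D (Suc t)} \<noteq> {}" using g(2) by force
    qed (use g node in auto)
    also have "\<dots> \<le> (\<Sum>i = 1..num_nodes D (Suc t). \<gamma> s i * h (node D i))"
      using g node h by (intro sum_mono mult_left_mono) auto
    finally show "v (dynamics P x u (scenario P s)) \<le>
      (\<Sum>i = 1..num_nodes D (Suc t). \<gamma> s i * h (node D i))" .
  qed
  finally show ?thesis by (simp add: sum_distrib_left mult.assoc)
qed

text \<open>The interpolation weights are chosen scenario by scenario. Interpolating
  \<open>v\<close> costs \<omega> and replacing \<open>v\<close> by \<open>h\<close> costs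
  \<epsilon>; neither is amplified, since node weights and scenario probabilities sum to 1.\<close>

lemma (in semicontinuous_model) approx_bellman_feasible:
  assumes Z: "state_regions P Z" and D: "is_discretization (horizon P) Z D"
    and t: "t < horizon P" and x: "x \<in> Z t" and u: "u \<in> admissible P x"
    and osc: "cell_oscillation_le D (Suc t) v \<omega>"
    and h: "\<And>y. y \<in> Z (Suc t) \<Longrightarrow> h y \<le> v y + \<epsilon>"
  obtains \<gamma> where "\<And>s. s \<in> {1..num_scenarios P} \<Longrightarrow>
         dynamics P x u (scenario P s) = (\<Sum>i = 1..num_nodes D (Suc t). \<gamma> s i *\<^sub>R node D i) \<and>
         \<gamma> s \<in> unit_simplex (num_nodes D (Suc t))"
    "stage_cost P x u + (\<Sum>s = 1..num_scenarios P.
       \<Sum>i = 1..num_nodes D (Suc t). scenario_prob P s * \<gamma> s i * h (node D i)) \<le>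
     stage_cost P x u + (\<Sum>s = 1..num_scenarios P.
       scenario_prob P s * v (dynamics P x u (scenario P s))) + (\<omega> + \<epsilon>)"
proof -
  let ?M = "num_nodes D (Suc t)"
  have node: "node D i \<in> Z (Suc t)" if "i \<in> {1..?M}" for i
    using discretization_node_in_region[OF D] t that by simp
  have "\<exists>\<gamma>. \<gamma> \<in> unit_simplex ?M \<and>
    dynamics P x u (scenario P s) = (\<Sum>i = 1..?M. \<gamma> i *\<^sub>R node D i) \<and>
    (\<Sum>i = 1..?M. \<gamma> i * v (node D i)) \<le> v (dynamics P x u (scenario P s)) + \<omega>"
    if s: "s \<in> {1..num_scenarios P}" for s
  proof -
    have "dynamics P x u (scenario P s) \<in> Z (Suc t)"
      using Z t x u scenario_in_disturbances[OF s] unfolding state_regions_def by blast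
    then obtain \<gamma> where "\<gamma> \<in> unit_simplex ?M"
      "dynamics P x u (scenario P s) = (\<Sum>i = 1..?M. \<gamma> i *\<^sub>R node D i)"
      "(\<Sum>i = 1..?M. \<gamma> i * v (node D i)) \<le> v (dynamics P x u (scenario P s)) + \<omega>"
      by (rule discretization_interpolation[OF D Suc_leI[OF t] _ osc])
    then show ?thesis by blast
  qed
  then have "\<exists>\<gamma>. \<forall>s\<in>{1..num_scenarios P}. \<gamma> s \<in> unit_simplex ?M \<and>
    dynamics P x u (scenario P s) = (\<Sum>i = 1..?M. \<gamma> s i *\<^sub>R node D i) \<and>
    (\<Sum>i = 1..?M. \<gamma> s i * v (node D i)) \<le> v (dynamics P x u (scenario P s)) + \<omega>"
    by (intro bchoice ballI)
  then obtain \<gamma> where \<gamma>: "\<And>s. s \<in> {1..num_scenarios P} \<Longrightarrow> \<gamma> s \<in> unit_simplex ?M \<and>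
    dynamics P x u (scenario P s) = (\<Sum>i = 1..?M. \<gamma> s i *\<^sub>R node D i) \<and>
    (\<Sum>i = 1..?M. \<gamma> s i * v (node D i)) \<le> v (dynamics P x u (scenario P s)) + \<omega>"
    by blast
  have "(\<Sum>s = 1..num_scenarios P. \<Sum>i = 1..?M. scenario_prob P s * \<gamma> s i * h (node D i)) =
    (\<Sum>s = 1..num_scenarios P. scenario_prob P s * (\<Sum>i = 1..?M. \<gamma> s i * h (node D i)))"
    by (simp add: sum_distrib_left mult.assoc)
  also have "\<dots> \<le> (\<Sum>s = 1..num_scenarios P.
      scenario_prob P s * (v (dynamics P x u (scenario P s)) + (\<omega> + \<epsilon>)))"
  proof (intro sum_mono mult_left_mono scenario_prob_nonneg)
    fix s assume s: "s \<in> {1..num_scenarios P}"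
    have g: "\<And>i. i \<in> {1..?M} \<Longrightarrow> 0 \<le> \<gamma> s i" "sum (\<gamma> s) {1..?M} = 1"
      using \<gamma>[OF s] by (auto simp: unit_simplex_def)
    have "(\<Sum>i = 1..?M. \<gamma> s i * h (node D i)) \<le> (\<Sum>i = 1..?M. \<gamma> s i * (v (node D i) + \<epsilon>))"
      using g node h by (intro sum_mono mult_left_mono) auto
    also have "\<dots> = (\<Sum>i = 1..?M. \<gamma> s i * v (node D i)) + \<epsilon>"
      using g(2) by (simp add: distrib_left sum.distrib flip: sum_distrib_right)
    finally show "(\<Sum>i = 1..?M. \<gamma> s i * h (node D i)) \<le>
        v (dynamics P x u (scenario P s)) + (\<omega> + \<epsilon>)"
      using \<gamma>[OF s] by linarith
  qed
  also have "\<dots> = (\<Sum>s = 1..num_scenarios P.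
      scenario_prob P s * v (dynamics P x u (scenario P s))) + (\<omega> + \<epsilon>)"
    unfolding distrib_left[of _ _ "\<omega> + \<epsilon>"] sum.distrib
    using scenario_prob_sum by (simp flip: sum_distrib_right)
  finally show thesis using that[of \<gamma>] \<gamma> by auto
qed

text \<open>The two bounds are proved together because the lower one also shows that the set of
  objective values is bounded below, which the upper one needs in order to compare its infimum with
  a single element.\<close>

lemma (in semicontinuous_model) approx_bellman_bounds:
  assumes Z: "state_regions P Z" and D: "is_discretization (horizon P) Z D"
    and t: "t < horizon P" and x: "x \<in> Z t"
    and v: "convex_on (Z (Suc t)) v" "lsc_on (states P) v"
    and h: "\<And>y. y \<in> Z (Suc t) \<Longrightarrow> v y \<le> h y"
  shows bellman_le_approx_bellman: "bellman P v x \<le> approx_bellman P D t h x"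
    and approx_bellman_le: "\<lbrakk>cell_oscillation_le D (Suc t) v \<omega>;
      \<And>y. y \<in> Z (Suc t) \<Longrightarrow> h y \<le> v y + \<epsilon>\<rbrakk> \<Longrightarrow>
      approx_bellman P D t h x \<le> bellman P v x + (\<omega> + \<epsilon>)"
proof -
  let ?A = "{stage_cost P x u + (\<Sum>s = 1..num_scenarios P. \<Sum>i = 1..num_nodes D (Suc t).
        scenario_prob P s * \<gamma> s i * h (node D i)) | u \<gamma>.
      (\<forall>s \<in> {1..num_scenarios P}.
         dynamics P x u (scenario P s) = (\<Sum>i = 1..num_nodes D (Suc t). \<gamma> s i *\<^sub>R node D i) \<and>
         \<gamma> s \<in> unit_simplex (num_nodes D (Suc t))) \<and>
      u \<in> admissible P x}"
  have xS: "x \<in> states P" using state_regions_subset_states[OF Z, of t] t x by auto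
  then have Ane: "admissible P x \<noteq> {}" using admissible by blast
  have lower: "bellman P v x \<le> a" if "a \<in> ?A" for a
    using that approx_bellman_objective_ge[OF Z D t x _ v h] by blast
  have ne: "?A \<noteq> {}"
  proof -
    obtain u where u: "u \<in> admissible P x" using Ane by blast
    \<comment> \<open>feasibility, read off the interpolation of the zero function\<close>
    obtain \<gamma> where "\<And>s. s \<in> {1..num_scenarios P} \<Longrightarrow>
         dynamics P x u (scenario P s) = (\<Sum>i = 1..num_nodes D (Suc t). \<gamma> s i *\<^sub>R node D i) \<and>
         \<gamma> s \<in> unit_simplex (num_nodes D (Suc t))"
      by (rule approx_bellman_feasible[OF Z D t x u, of "\<lambda>_. 0" 0 "\<lambda>_. 0" 0])
        (auto simp: cell_oscillation_le_def)
    with u show ?thesis by blast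
  qed
  show "bellman P v x \<le> approx_bellman P D t h x"
    unfolding approx_bellman_def by (rule cInf_greatest[OF ne lower])
  assume osc: "cell_oscillation_le D (Suc t) v \<omega>"
    and \<epsilon>: "\<And>y. y \<in> Z (Suc t) \<Longrightarrow> h y \<le> v y + \<epsilon>"
  \<comment> \<open>With the error on the left, it suffices to bound the exact objective for each
    single action.\<close>
  have "approx_bellman P D t h x - (\<omega> + \<epsilon>) \<le> bellman P v x"
    unfolding bellman_def
  proof (rule cINF_greatest[OF Ane])
    fix u assume u: "u \<in> admissible P x"
    obtain \<gamma> where \<gamma>: "\<And>s. s \<in> {1..num_scenarios P} \<Longrightarrow>
         dynamics P x u (scenario P s) = (\<Sum>i = 1..num_nodes D (Suc t). \<gamma> s i *\<^sub>R node D i) \<and>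
         \<gamma> s \<in> unit_simplex (num_nodes D (Suc t))"
    "stage_cost P x u + (\<Sum>s = 1..num_scenarios P.
       \<Sum>i = 1..num_nodes D (Suc t). scenario_prob P s * \<gamma> s i * h (node D i)) \<le>
     stage_cost P x u + (\<Sum>s = 1..num_scenarios P.
       scenario_prob P s * v (dynamics P x u (scenario P s))) + (\<omega> + \<epsilon>)"
      by (rule approx_bellman_feasible[where h = h and v = v, OF Z D t x u osc \<epsilon>]) blast+
    have "approx_bellman P D t h x \<le> stage_cost P x u + (\<Sum>s = 1..num_scenarios P.
       \<Sum>i = 1..num_nodes D (Suc t). scenario_prob P s * \<gamma> s i * h (node D i))"
      unfolding approx_bellman_def using \<gamma>(1) u lower
      by (intro cInf_lower) (blast, auto simp: bdd_below_def)
    with \<gamma>(2) show "approx_bellman P D t h x - (\<omega> + \<epsilon>) \<le> stage_cost P x u +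
        (\<Sum>s = 1..num_scenarios P. scenario_prob P s * v (dynamics P x u (scenario P s)))"
      by linarith
  qed
  then show "approx_bellman P D t h x \<le> bellman P v x + (\<omega> + \<epsilon>)" by linarith
qed

section \<open>Accumulation of the error over time\<close>

lemma (in semicontinuous_model) v_opt_le_v_hat:
  assumes Z: "state_regions P Z" and D: "is_discretization (horizon P) Z D"
    and v: "\<And>t. t \<le> horizon P \<Longrightarrow> convex_on (Z t) (v_opt P t)"
    and t: "t \<le> horizon P"
  shows "x \<in> Z t \<Longrightarrow> v_opt P t x \<le> v_hat P D t x"
  using t
proof (induction arbitrary: x rule: inc_induct)
  case base
  show ?case by (simp add: v_opt_horizon v_hat_horizon)
next
  case (step n)
  then show ?case
    by (simp add: v_opt_Suc v_hat_Suc)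
      (intro bellman_le_approx_bellman[OF Z D] v v_opt_lsc; simp)
qed

text \<open>The operator at stage \<open>t\<close> interpolates only the value function of stage
  \<open>t+1\<close>, so each backward step adds exactly the next oscillation bound; this is why the
  sum starts at \<open>t+1\<close> and is empty at the horizon.\<close>

lemma (in semicontinuous_model) v_hat_le:
  assumes Z: "state_regions P Z" and D: "is_discretization (horizon P) Z D"
    and v: "\<And>t. t \<le> horizon P \<Longrightarrow> convex_on (Z t) (v_opt P t)"
    and t: "t \<le> horizon P"
    and osc: "\<forall>k\<in>{t+1..horizon P}. cell_oscillation_le D k (v_opt P k) (\<omega> k)"
  shows "x \<in> Z t \<Longrightarrow> v_hat P D t x \<le> v_opt P t x + (\<Sum>k = t+1..horizon P. \<omega> k)"
  using t osc
proof (induction arbitrary: x rule: inc_induct)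
  case base
  show ?case by (simp add: v_opt_horizon v_hat_horizon)
next
  case (step n)
  have IH: "v_hat P D (Suc n) y \<le> v_opt P (Suc n) y + (\<Sum>k = Suc n + 1..horizon P. \<omega> k)"
    if "y \<in> Z (Suc n)" for y
    using step.prems(2) by (intro step.IH[OF that]) simp
  have "v_hat P D n x \<le> v_opt P n x + (\<omega> (Suc n) + (\<Sum>k = Suc n + 1..horizon P. \<omega> k))"
    unfolding v_opt_Suc[OF step.hyps(2)] v_hat_Suc[OF step.hyps(2)]
  proof (rule approx_bellman_le[OF Z D step.hyps(2) step.prems(1)])
    show "convex_on (Z (Suc n)) (v_opt P (Suc n))" using v step.hyps by simp
    show "lsc_on (states P) (v_opt P (Suc n))" using v_opt_lsc step.hyps by simp
    show "v_opt P (Suc n) y \<le> v_hat P D (Suc n) y" if "y \<in> Z (Suc n)" for y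
      using v_opt_le_v_hat[OF Z D v] step.hyps that by simp
    show "cell_oscillation_le D (Suc n) (v_opt P (Suc n)) (\<omega> (Suc n))"
      using step.prems(2) step.hyps by simp
  qed (rule IH)
  also have "\<omega> (Suc n) + (\<Sum>k = Suc n + 1..horizon P. \<omega> k) = (\<Sum>k = n + 1..horizon P. \<omega> k)"
    using sum.atLeast_Suc_atMost[of "n + 1" "horizon P" \<omega>] step.hyps by simp
  finally show ?case .
qed

text \<open>For distinct points, the difference quotient is at most the Lipschitz constant and the
  distance at most the mesh. Working in \<open>ennreal\<close> covers infinite constants
  too.\<close>

lemma v_opt_diff_le_cell_lipschitz:
  assumes D: "is_discretization (horizon P) Z D" and k: "k \<le> horizon P"
    and j: "j \<in> {1..num_cells D k}" and x: "x \<in> cell D j" "x' \<in> cell D j"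
  shows "ennreal \<bar>v_opt P k x - v_opt P k x'\<bar> \<le>
    cell_lipschitz P D k * ennreal (mesh (horizon P) D)"
proof (cases "x = x'")
  case False
  let ?q = "\<bar>v_opt P k x - v_opt P k x'\<bar> / norm (x - x')"
  have "ennreal ?q \<le> cell_lipschitz P D k"
    unfolding cell_lipschitz_def using j x False
    by (intro SUP_upper2[OF j] SUP_upper2[of "(x, x')"]) auto
  moreover have "ennreal (norm (x - x')) \<le> ennreal (mesh (horizon P) D)"
    using cell_dist_le_mesh[OF D k j x] by (intro ennreal_leI) (simp add: dist_norm)
  ultimately have "ennreal ?q * ennreal (norm (x - x')) \<le>
      cell_lipschitz P D k * ennreal (mesh (horizon P) D)"
    by (rule mult_mono) auto
  also have "ennreal ?q * ennreal (norm (x - x')) = ennreal \<bar>v_opt P k x - v_opt P k x'\<bar>"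
    using False by (simp flip: ennreal_mult)
  finally show ?thesis .
qed simp

lemma (in semicontinuous_model) v_hat_error_le_cell_lipschitz:
  assumes Z: "state_regions P Z" and D: "is_discretization (horizon P) Z D"
    and v: "\<And>t. t \<le> horizon P \<Longrightarrow> convex_on (Z t) (v_opt P t)"
    and t: "t \<le> horizon P" and x: "x \<in> Z t"
  shows "ennreal (v_hat P D t x - v_opt P t x) \<le>
    (\<Sum>k = t+1..horizon P. cell_lipschitz P D k * ennreal (mesh (horizon P) D))"
    (is "_ \<le> (\<Sum>k = t+1..horizon P. ?b k)")
\<comment> \<open>An infinite bound is vacuous. It is split off first because
  \<open>enn2real\<close> sends \<top> to 0, so the passage to real oscillation bounds is sound only
  for finite terms.\<close>
proof (cases "(\<Sum>k = t+1..horizon P. ?b k) = \<top>")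
  case False
  then have fin: "?b k \<noteq> \<top>" if "k \<in> {t+1..horizon P}" for k
    using that by auto
  have osc: "\<bar>v_opt P k y - v_opt P k y'\<bar> \<le> enn2real (?b k)"
    if "k \<in> {t+1..horizon P}" "j \<in> {1..num_cells D k}" "y \<in> cell D j" "y' \<in> cell D j" for k j y y'
    using v_opt_diff_le_cell_lipschitz[OF D _ that(2-4)] that(1) fin[OF that(1)]
    by (metis abs_ge_zero atLeastAtMost_iff enn2real_ennreal enn2real_mono top.not_eq_extremum)
  have "\<forall>k\<in>{t+1..horizon P}. cell_oscillation_le D k (v_opt P k) (enn2real (?b k))"
    unfolding cell_oscillation_le_def using osc by blast
  from v_hat_le[OF Z D v t this x]
  have "v_hat P D t x - v_opt P t x \<le> (\<Sum>k = t+1..horizon P. enn2real (?b k))" by simp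
  then have "ennreal (v_hat P D t x - v_opt P t x) \<le> ennreal (\<Sum>k = t+1..horizon P. enn2real (?b k))"
    by (rule ennreal_leI)
  also have "\<dots> = (\<Sum>k = t+1..horizon P. ennreal (enn2real (?b k)))"
    by (simp add: sum_ennreal)
  also have "\<dots> = (\<Sum>k = t+1..horizon P. ?b k)"
    using fin by (intro sum.cong refl ennreal_enn2real) (simp add: top.not_eq_extremum)
  finally show ?thesis .
next
  case True
  show ?thesis unfolding True by simp
qed

text \<open>The Lipschitz constants may be infinite, so uniform convergence is obtained from the uniform
  continuity of the optimal value functions instead.\<close>

lemma (in semicontinuous_model) v_hat_uniform_limit:
  assumes Z: "state_regions P Z"
    and v: "\<And>t. t \<le> horizon P \<Longrightarrow> convex_on (Z t) (v_opt P t)"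
    and t: "t \<le> horizon P"
  shows "uniform_limit (Z t) (\<lambda>D. v_hat P D t) (v_opt P t) (fine_discretizations (horizon P) Z)"
proof (rule uniform_limitI)
  fix e :: real assume e: "0 < e"
  let ?K = "horizon P"
  show "\<forall>\<^sub>F D in fine_discretizations ?K Z. \<forall>x\<in>Z t. dist (v_hat P D t x) (v_opt P t x) < e"
  \<comment> \<open>Without any discretization the filter is trivial. Otherwise a single one,
    unrelated to the limit, shows that the regions are polytopes.\<close>
  proof (cases "\<exists>D. is_discretization ?K Z D")
    case False
    then show ?thesis by (simp add: fine_discretizations_def)
  next
    case True
    then obtain D0 where D0: "is_discretization ?K Z D0" ..
    \<comment> \<open>At most \<open>?K\<close> stages contribute \<open>e'\<close> each; the extra
      1 in the denominator makes the total strictly less than \<open>e\<close>.\<close>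
    define e' where "e' = e / (real ?K + 1)"
    have e': "0 < e'" using e by (simp add: e'_def)
    have "uniformly_continuous_on (Z k) (v_opt P k)" if k: "k \<le> ?K" for k
    proof (rule compact_uniformly_continuous)
      have ZK: "convex (Z k)" "compact (Z k)" using Z k by (auto simp: state_regions_def)
      then show "compact (Z k)" by simp
      have "lsc_on (Z k) (v_opt P k)"
        using lsc_on_compose[OF v_opt_lsc[OF k] continuous_on_id]
          state_regions_subset_states[OF Z k] by simp
      then show "continuous_on (Z k) (v_opt P k)"
        using convex_on_polytope_lsc_imp_continuous discretization_region_polytope[OF D0 k] ZK v k
        by blast
    qed
    then have "\<exists>d>0. \<forall>x\<in>Z k. \<forall>x'\<in>Z k. dist x' x < d \<longrightarrow> dist (v_opt P k x') (v_opt P k x) < e'"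
      if "k \<le> ?K" for k
      using that e' unfolding uniformly_continuous_on_def by blast
    then obtain d where d: "\<And>k. k \<le> ?K \<Longrightarrow> 0 < d k"
      "\<And>k x x'. k \<le> ?K \<Longrightarrow> x \<in> Z k \<Longrightarrow> x' \<in> Z k \<Longrightarrow> dist x' x < d k \<Longrightarrow>
        dist (v_opt P k x') (v_opt P k x) < e'"
      by metis
    \<comment> \<open>There are finitely many stages, so one mesh threshold serves all of
      them.\<close>
    define d0 where "d0 = Min (d ` {..?K})"
    have d0: "0 < d0" "\<And>k. k \<le> ?K \<Longrightarrow> d0 \<le> d k" using d(1) by (auto simp: d0_def)
    have close: "dist (v_hat P D t x) (v_opt P t x) < e"
      if D: "is_discretization ?K Z D" and m: "mesh ?K D < d0" and x: "x \<in> Z t" for D x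
    proof -
      have osc: "\<bar>v_opt P k y - v_opt P k y'\<bar> \<le> e'"
        if kj: "k \<in> {t+1..?K}" "j \<in> {1..num_cells D k}" and y: "y \<in> cell D j" "y' \<in> cell D j"
        for k j y y'
      proof -
        have k: "k \<le> ?K" using kj by simp
        have "cell D j \<subseteq> Z k" using discretization_region_eq[OF D k] kj(2) by blast
        moreover have "dist y y' < d k"
          using cell_dist_le_mesh[OF D k kj(2) y] m d0(2)[OF k] by linarith
        ultimately show ?thesis using d(2)[OF k] y by (fastforce simp: dist_real_def)
      qed
      have "\<forall>k\<in>{t+1..?K}. cell_oscillation_le D k (v_opt P k) e'"
        unfolding cell_oscillation_le_def using osc by blast
      from v_hat_le[OF Z D v t this x]
      have "v_hat P D t x - v_opt P t x \<le> real (?K - t) * e'" by simp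
      also have "\<dots> < (real ?K + 1) * e'" using e' t by (intro mult_strict_right_mono) auto
      also have "\<dots> = e" by (simp add: e'_def)
      finally show ?thesis using v_opt_le_v_hat[OF Z D v t x] by (simp add: dist_real_def)
    qed
    have "\<forall>\<^sub>F D in filtercomap (mesh ?K) (nhds 0). mesh ?K D < d0"
      using d0(1) order_tendstoD(2)[OF filterlim_filtercomap] by blast
    then show ?thesis
      unfolding fine_discretizations_def eventually_inf_principal
      by eventually_elim (use close in blast)
  qed
qed

theorem theorem1:
  fixes P :: "(real ^ 'n, real ^ 'm, real ^ 'l, 'o) control_problem"
    and Z :: "nat \<Rightarrow> (real ^ 'n) set"
  assumes "semicontinuous_model P"
    and "state_regions P Z"
    and "\<And>t. t \<le> horizon P \<Longrightarrow> convex_on (Z t) (v_opt P t)"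
  shows "(\<forall>D. is_discretization (horizon P) Z D \<longrightarrow>
           (\<forall>t \<le> horizon P. \<forall>x \<in> Z t.
              0 \<le> v_hat P D t x - v_opt P t x \<and>
              ennreal (v_hat P D t x - v_opt P t x) \<le>
                (\<Sum>k = t+1..horizon P. cell_lipschitz P D k * ennreal (mesh (horizon P) D)))) \<and>
         (\<forall>t \<le> horizon P.
            uniform_limit (Z t) (\<lambda>D. v_hat P D t) (v_opt P t)
              (fine_discretizations (horizon P) Z))"
proof -
  interpret semicontinuous_model P by fact
  show ?thesis
    using v_opt_le_v_hat[OF assms(2) _ assms(3)] v_hat_error_le_cell_lipschitz[OF assms(2) _ assms(3)]
      v_hat_uniform_limit[OF assms(2,3)]
    by (intro conjI allI impI ballI) auto
qed

end
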